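(* Let $F$ be a field of characteristic $0$, and let $\mathcal{R}=\{J_a\circ l_r\mid a\in F,\ r\in F[x]\setminus\{0\}\}$. (1) The correspondence $F\times(F[x]\setminus\{0\})\to\mathcal{R}$, $(a,r)\mapsto J_a\circ l_r$, is bijective. In particular, $\mathcal{R}$ admits a natural structure of a quasi-affine ind-variety. (2) The operator action map $\mathcal{R}\times F[x]\to F[x]$, $(R,f)\mapsto R(f)$, is an ind-morphism.
   Context: On $F[x]$: $l_r\colon f\mapsto rf$ is multiplication by $r\in F[x]$; for $a\in F$, $J_a$ is the linear operator with $J_a(x^n)=\frac{x^{n+1}-a^{n+1}}{n+1}$ for $n\ge0$; $\circ$ is composition. The set $\mathcal{R}$ is the set of all injective Rota--Baxter operators of weight zero on $F[x]$, i.e. of injective linear operators $R$ with $R(f)R(g)=R(R(f)g+fR(g))$ for all $f,g$. Ind-varieties: given an ascending sequence of closed embeddings of algebraic varieties $X_1\hookrightarrow X_2\hookrightarrow\ldots$, the inductive limit $X=\varinjlim X_n$ is called an ind-variety. A morphism (ind-morphism) $\phi\colon \varinjlim X_n\to\varinjlim Y_n$ is a collection of morphisms $\phi_n\colon X_n\to Y_{n'}$, one for each $n$, where $n'$ depends on $n$, with $\phi_{n+1}|_{X_n}=\phi_n$. Two sequences on $X$ are equivalent if the identity map between the corresponding inductive limits is an isomorphism of ind-varieties. $X$ is quasi-affine if all $X_n$ are quasi-affine, up to equivalence. Products: $X\times Y=\varinjlim X_n\times Y_n$. Structures used: with $F[x]_{\le d}$ the space of polynomials of degree at most $d$, identified with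 the affine space $\mathbb{A}^{d+1}$ by coefficients, $F[x]=\varinjlim F[x]_{\le d}$ and $F[x]\setminus\{0\}=\varinjlim (F[x]_{\le d}\setminus\{0\})$. The ind-structure on $\mathcal{R}$ is the one transported by the bijection in (1) from $F\times(F[x]\setminus\{0\})=\varinjlim F\times (F[x]_{\le d}\setminus\{0\})$, with $F=\mathbb{A}^1$. *)

theory Defs
  imports "HOL-Algebra.Algebraic_Closure_Type"
begin

hide_const (open) Polynomials.degree

section \<open>Operators on the polynomial ring\<close>

definition mult_op :: "'a::field_char_0 poly \<Rightarrow> 'a poly \<Rightarrow> 'a poly"
  where "mult_op r = (\<lambda>f. r * f)"

text \<open>The linear extension of \<open>x^n \<mapsto> (x^(n+1) - a^(n+1)) / (n+1)\<close>; see \<open>J_add\<close>, \<open>J_smult\<close>, \<open>J_monom\<close>.\<close>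

definition J :: "'a::field_char_0 \<Rightarrow> 'a poly \<Rightarrow> 'a poly"
  where "J a f = (\<Sum>n\<le>degree f.
           smult (Polynomial.coeff f n / of_nat (Suc n)) (Polynomial.monom 1 (Suc n) - [:a ^ Suc n:]))"

definition RB_ops :: "('a::field_char_0 poly \<Rightarrow> 'a poly) set"
  where "RB_ops = {J a \<circ> mult_op r | a r. r \<noteq> 0}"

definition injective_rota_baxter :: "('a::field_char_0 poly \<Rightarrow> 'a poly) \<Rightarrow> bool"
  where "injective_rota_baxter R \<longleftrightarrow>
           (\<forall>f g. R (f + g) = R f + R g) \<and> (\<forall>c f. R (smult c f) = smult c (R f)) \<and>
           inj R \<and> (\<forall>f g. R f * R g = R (R f * g + f * R g))"

lemma J_eq:
  assumes "degree f \<le> N"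
  shows "J a f = (\<Sum>n\<le>N. smult (Polynomial.coeff f n / of_nat (Suc n)) (Polynomial.monom 1 (Suc n) - [:a ^ Suc n:]))"
  unfolding J_def
  by (rule sum.mono_neutral_left) (use assms in \<open>auto simp: coeff_eq_0\<close>)

lemma J_add: "J a (f + g) = J a f + J a g"
proof -
  define N where "N = max (degree f) (degree g)"
  have "degree f \<le> N" "degree g \<le> N" "degree (f + g) \<le> N"
    by (auto simp: N_def degree_add_le_max)
  then show ?thesis
    by (simp only: J_eq) (simp add: sum.distrib add_divide_distrib smult_add_left)
qed

lemma J_smult: "J a (smult c f) = smult c (J a f)"
proof -
  have "degree (smult c f) \<le> degree f" by simp
  then show ?thesis
    by (simp only: J_eq[of f "degree f"] J_eq[of "smult c f" "degree f"] order_refl)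
      (simp add: sum_distrib_left flip: monom_0 mult_monom, simp add: poly_eq_iff coeff_sum sum_distrib_left mult.assoc)
qed

lemma J_monom: "J a (Polynomial.monom 1 n) = smult (1 / of_nat (Suc n)) (Polynomial.monom 1 (Suc n) - [:a ^ Suc n:])"
proof -
  have "degree (Polynomial.monom (1::'a) n) = n" by (simp add: degree_monom_eq)
  then have "J a (Polynomial.monom 1 n) = (\<Sum>k\<in>{n}. smult (Polynomial.coeff (Polynomial.monom 1 n) k / of_nat (Suc k))
               (Polynomial.monom 1 (Suc k) - [:a ^ Suc k:]))"
    unfolding J_def by (intro sum.mono_neutral_right) auto
  then show ?thesis by simp
qed

lemma poly_J: "poly (J a f) a = 0"
  by (simp add: J_def poly_sum poly_monom)

lemma pderiv_J: "pderiv (J a f) = f"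
proof -
  have "pderiv (J a f) = (\<Sum>n\<le>degree f. Polynomial.monom (Polynomial.coeff f n) n)"
    unfolding J_def
    by (simp add: higher_pderiv_sum[of 1, simplified] pderiv_smult pderiv_diff pderiv_monom pderiv_pCons smult_monom
             del: of_nat_Suc)
  then show ?thesis by (simp add: poly_as_sum_of_monoms)
qed

lemma eq_J:
  assumes "pderiv p = f" "poly p a = 0"
  shows "p = J a f"
proof -
  have "pderiv (p - J a f) = 0" using assms by (simp add: pderiv_diff pderiv_J)
  then obtain h where h: "p - J a f = [:h:]"
    by (metis degree_eq_zeroE pderiv_eq_0_iff)
  then have "h = poly (p - J a f) a" by simp
  also have "\<dots> = 0" using assms by (simp add: poly_J)
  finally show ?thesis using h by simp
qed

text \<open>The converse also holds: every injective Rota--Baxter operator of weight zero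
  belongs to \<^term>\<open>RB_ops\<close>. This is the classification theorem for these operators; it is
  not needed below.\<close>

lemma RB_ops_injective_rota_baxter:
  assumes "R \<in> RB_ops"
  shows "injective_rota_baxter R"
proof -
  obtain a r where R: "R = (\<lambda>f. J a (r * f))" and r: "r \<noteq> 0"
    using assms by (auto simp: RB_ops_def mult_op_def o_def)
  have "inj R"
    by (metis R pderiv_J r injI mult_left_cancel)
  moreover have "R f * R g = R (R f * g + f * R g)" for f g
    unfolding R
    by (rule eq_J) (auto simp: pderiv_mult pderiv_J poly_J algebra_simps)
  ultimately show ?thesis
    by (auto simp: injective_rota_baxter_def R J_add J_smult distrib_left)
qed


section \<open>Quasi-affine varieties over a field\<close>

text \<open>
  A quasi-affine variety over \<open>F\<close> is given by its set of points over the algebraic closure of \<open>F\<close>: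
  a difference of two algebraic sets in an affine space, both cut out by polynomials with
  coefficients in \<open>F\<close>. Varieties need not be irreducible. Working over the closure
  matters when \<open>F\<close> is not algebraically closed: on \<open>F\<close>-rational points alone, a function such as
  \<open>1 / (x^2 + 1)\<close> over the reals would count as regular on the affine line.

  The coordinates of an affine space are indexed by a finite set \<open>I\<close>; its points are functions
  on the index type that vanish outside \<open>I\<close>.
\<close>

definition affine_space :: "'i set \<Rightarrow> ('i \<Rightarrow> 'a::field alg_closure) set"
  where "affine_space I = {x. \<forall>i. i \<notin> I \<longrightarrow> x i = 0}"

inductive_set poly_fun :: "'i set \<Rightarrow> (('i \<Rightarrow> 'a::field alg_closure) \<Rightarrow> 'a alg_closure) set"
  for I :: "'i set" where
  const: "(\<lambda>x. to_ac c) \<in> poly_fun I"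
| coord: "i \<in> I \<Longrightarrow> (\<lambda>x. x i) \<in> poly_fun I"
| add: "p \<in> poly_fun I \<Longrightarrow> q \<in> poly_fun I \<Longrightarrow> (\<lambda>x. p x + q x) \<in> poly_fun I"
| mult: "p \<in> poly_fun I \<Longrightarrow> q \<in> poly_fun I \<Longrightarrow> (\<lambda>x. p x * q x) \<in> poly_fun I"

definition algebraic_set :: "'i set \<Rightarrow> ('i \<Rightarrow> 'a::field alg_closure) set \<Rightarrow> bool"
  where "algebraic_set I Z \<longleftrightarrow>
           (\<exists>P \<subseteq> poly_fun I. Z = {x \<in> affine_space I. \<forall>p\<in>P. p x = 0})"

definition quasi_affine_variety :: "'i set \<Rightarrow> ('i \<Rightarrow> 'a::field alg_closure) set \<Rightarrow> bool"
  where "quasi_affine_variety I V \<longleftrightarrow>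
           finite I \<and> (\<exists>Z Z'. algebraic_set I Z \<and> algebraic_set I Z' \<and> V = Z - Z')"

definition regular_fun ::
  "'i set \<Rightarrow> ('i \<Rightarrow> 'a::field alg_closure) set \<Rightarrow> (('i \<Rightarrow> 'a alg_closure) \<Rightarrow> 'a alg_closure) \<Rightarrow> bool"
  where "regular_fun I V f \<longleftrightarrow>
           (\<forall>x\<in>V. \<exists>p\<in>poly_fun I. \<exists>q\<in>poly_fun I.
              q x \<noteq> 0 \<and> (\<forall>y\<in>V. q y \<noteq> 0 \<longrightarrow> f y = p y / q y))"

definition variety_morphism ::
  "'i set \<Rightarrow> ('i \<Rightarrow> 'a::field alg_closure) set \<Rightarrow> 'j set \<Rightarrow> ('j \<Rightarrow> 'a alg_closure) set \<Rightarrow>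
    (('i \<Rightarrow> 'a alg_closure) \<Rightarrow> ('j \<Rightarrow> 'a alg_closure)) \<Rightarrow> bool"
  where "variety_morphism I V I' W f \<longleftrightarrow>
           f ` V \<subseteq> W \<and> (\<forall>j\<in>I'. regular_fun I V (\<lambda>x. f x j))"

definition closed_embedding ::
  "'i set \<Rightarrow> ('i \<Rightarrow> 'a::field alg_closure) set \<Rightarrow> 'j set \<Rightarrow> ('j \<Rightarrow> 'a alg_closure) set \<Rightarrow>
    (('i \<Rightarrow> 'a alg_closure) \<Rightarrow> ('j \<Rightarrow> 'a alg_closure)) \<Rightarrow> bool"
  where "closed_embedding I V I' W f \<longleftrightarrow>
           variety_morphism I V I' W f \<and> inj_on f V \<and>
           (\<exists>Z. algebraic_set I' Z \<and> f ` V = W \<inter> Z) \<and>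
           variety_morphism I' (f ` V) I V (inv_into V f)"


section \<open>Quasi-affine ind-varieties\<close>

text \<open>
  The inductive limit is presented as an ascending union of sets \<open>stage A n\<close> (points over the
  algebraic closure), where \<open>chart A n\<close> identifies the \<open>n\<close>-th one with a quasi-affine variety in
  the affine space with coordinates \<open>coords A n\<close>. The transition maps of the inductive system
  are the inclusions of stages, read in charts.

  An ind-structure on a set \<open>S\<close> consists of such a limit together with a bijection
  \<open>pt A\<close> from \<open>S\<close> onto its \<open>F\<close>-rational points.
\<close>

record (overloaded) ('s, 'p, 'i, 'a) ind_structure =
  stage :: "nat \<Rightarrow> 'p set"
  coords :: "nat \<Rightarrow> 'i set"
  chart :: "nat \<Rightarrow> 'p \<Rightarrow> ('i \<Rightarrow> 'a alg_closure)"
  pt :: "'s \<Rightarrow> 'p"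

definition rational_points :: "('s, 'p, 'i, 'a::field) ind_structure \<Rightarrow> 'p set"
  where "rational_points A = {x. \<exists>n. x \<in> stage A n \<and> range (chart A n x) \<subseteq> range to_ac}"

definition in_charts ::
  "('s, 'p, 'i, 'a::field) ind_structure \<Rightarrow> nat \<Rightarrow> ('t, 'q, 'j, 'a) ind_structure \<Rightarrow> nat \<Rightarrow>
    ('p \<Rightarrow> 'q) \<Rightarrow> ('i \<Rightarrow> 'a alg_closure) \<Rightarrow> ('j \<Rightarrow> 'a alg_closure)"
  where "in_charts A n B m \<Phi> = chart B m \<circ> \<Phi> \<circ> inv_into (stage A n) (chart A n)"

definition quasi_affine_ind_variety :: "'s set \<Rightarrow> ('s, 'p, 'i, 'a::field) ind_structure \<Rightarrow> bool"
  where "quasi_affine_ind_variety S A \<longleftrightarrow>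
           (\<forall>n. inj_on (chart A n) (stage A n) \<and>
                quasi_affine_variety (coords A n) (chart A n ` stage A n) \<and>
                stage A n \<subseteq> stage A (Suc n) \<and>
                closed_embedding (coords A n) (chart A n ` stage A n)
                  (coords A (Suc n)) (chart A (Suc n) ` stage A (Suc n))
                  (in_charts A n A (Suc n) id)) \<and>
           bij_betw (pt A) S (rational_points A)"

text \<open>
  A family of morphisms from the stages of \<open>A\<close> to stages of \<open>B\<close>, compatible with the inclusions, is
  the same as a single map \<open>\<Phi>\<close> on the union of the stages whose restriction to each stage is a
  morphism into some stage of \<open>B\<close>. A map between the underlying sets is an ind-morphism if it is
  induced by such a \<open>\<Phi>\<close>.
\<close>

definition ind_morphism ::
  "'s set \<Rightarrow> ('s, 'p, 'i, 'a::field) ind_structure \<Rightarrow> 't set \<Rightarrow> ('t, 'q, 'j, 'a) ind_structure \<Rightarrow>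
    ('s \<Rightarrow> 't) \<Rightarrow> bool"
  where "ind_morphism S A T B f \<longleftrightarrow>
           quasi_affine_ind_variety S A \<and> quasi_affine_ind_variety T B \<and> f ` S \<subseteq> T \<and>
           (\<exists>\<Phi>. (\<forall>n. \<exists>m. \<Phi> ` stage A n \<subseteq> stage B m \<and>
                    variety_morphism (coords A n) (chart A n ` stage A n)
                      (coords B m) (chart B m ` stage B m) (in_charts A n B m \<Phi>)) \<and>
                (\<forall>s\<in>S. \<Phi> (pt A s) = pt B (f s)))"

definition ind_prod ::
  "('s, 'p, 'i, 'a::field) ind_structure \<Rightarrow> ('t, 'q, 'j, 'a) ind_structure \<Rightarrow>
    ('s \<times> 't, 'p \<times> 'q, 'i + 'j, 'a) ind_structure" (infixr "\<times>\<^sub>i" 80)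
  where "A \<times>\<^sub>i B =
    \<lparr>stage = (\<lambda>n. stage A n \<times> stage B n),
     coords = (\<lambda>n. Inl ` coords A n \<union> Inr ` coords B n),
     chart = (\<lambda>n (x, y). case_sum (chart A n x) (chart B n y)),
     pt = map_prod (pt A) (pt B)\<rparr>"

text \<open>The structure on \<open>\<phi> ` S\<close> making the bijection \<open>\<phi>\<close> from \<open>S\<close> onto \<open>\<phi> ` S\<close> an isomorphism.\<close>

definition ind_transport ::
  "'s set \<Rightarrow> ('s \<Rightarrow> 't) \<Rightarrow> ('s, 'p, 'i, 'a::field) ind_structure \<Rightarrow> ('t, 'p, 'i, 'a) ind_structure"
  where "ind_transport S \<phi> A =
    \<lparr>stage = stage A, coords = coords A, chart = chart A, pt = pt A \<circ> inv_into S \<phi>\<rparr>"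

definition ind_line :: "('a, 'a alg_closure, unit, 'a::field) ind_structure"
  where "ind_line =
    \<lparr>stage = (\<lambda>_. UNIV), coords = (\<lambda>_. UNIV), chart = (\<lambda>_ a _. a), pt = to_ac\<rparr>"

definition ind_poly :: "('a poly, 'a alg_closure poly, nat, 'a::field) ind_structure"
  where "ind_poly =
    \<lparr>stage = (\<lambda>d. {p. degree p \<le> d}), coords = (\<lambda>d. {..d}),
     chart = (\<lambda>_. Polynomial.coeff), pt = map_poly to_ac\<rparr>"

definition ind_poly_nonzero :: "('a poly, 'a alg_closure poly, nat, 'a::field) ind_structure"
  where "ind_poly_nonzero =
    \<lparr>stage = (\<lambda>d. {p. p \<noteq> 0 \<and> degree p \<le> d}), coords = (\<lambda>d. {..d}),
     chart = (\<lambda>_. Polynomial.coeff), pt = map_poly to_ac\<rparr>"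

definition ind_RB ::
  "('a poly \<Rightarrow> 'a poly, 'a alg_closure \<times> 'a alg_closure poly, unit + nat, 'a::field_char_0) ind_structure"
  where "ind_RB =
           ind_transport (UNIV \<times> {r. r \<noteq> 0}) (\<lambda>(a, r). J a \<circ> mult_op r)
             (ind_line \<times>\<^sub>i ind_poly_nonzero)"

end

theory Submission
  imports Defs
begin

text \<open>
  The operator \<open>J a\<close> is integration from \<open>a\<close>, so differentiating \<open>J a (r * 1)\<close> recovers \<open>r\<close>. To
  recover \<open>a\<close> one must see that \<open>\<integral> r f\<close> between two distinct points cannot vanish for every
  \<open>f\<close>. Over a general field there is no positivity argument; instead integration by parts lowers
  the order of vanishing of \<open>r\<close> at the upper endpoint until it is zero, where an explicit \<open>f\<close>
  works (\<open>J_eq_0_imp_eq\<close>). This makes \<open>(a, r) \<mapsto> J a \<circ> mult_op r\<close> bijective.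

  The ind-structure on \<^term>\<open>RB_ops\<close> is transported along this bijection from a product, so
  it is enough that the affine line, the polynomials and the nonzero polynomials form quasi-affine
  ind-varieties and that products preserve this property. For products, almost everything holds
  factor by factor because polynomial and regular functions can be pulled back along a renaming
  of coordinates (\<open>regular_fun_reindex\<close>). Two points need an argument: a product of differences of
  algebraic sets is again such a difference (\<open>quasi_affine_variety_prod\<close>), and a pair of
  rational points found at different stages is rational at a common stage, because the transition
  maps are defined over the base field (\<open>rational_chart_mono\<close>).

  Finally \<open>J a (r * f)\<close> has coefficients that are polynomials, with rational coefficients, in \<open>a\<close>
  and the coefficients of \<open>r\<close> and \<open>f\<close>. The same formula therefore defines the action on points
  over the algebraic closure, sends stage \<open>n\<close> to stage \<open>2 * n + 1\<close>, and is a morphism there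
  (\<open>ind_morphism_action\<close>).
\<close>

section \<open>The parametrization is injective\<close>

text \<open>
  Suppose \<open>a \<noteq> b\<close>, and write \<open>d\<close> for \<open>x - a\<close>. If \<open>r\<close> does not vanish at \<open>b\<close>, then \<open>d * r\<^sup>2\<close> is the
  integral from \<open>a\<close> of a multiple of \<open>r\<close> and has nonzero value at \<open>b\<close>. If \<open>r\<close> vanishes at \<open>b\<close>, so
  does \<open>d * r * f\<close>; as this product is the integral of \<open>d * r' * f + r * (d * f)'\<close>, the
  hypothesis passes from \<open>r\<close> to \<open>d * r'\<close>, whose order at \<open>b\<close> is smaller by one.
\<close>

lemma J_eq_0_imp_eq:
  fixes r :: "'a::field_char_0 poly"
  assumes "r \<noteq> 0" "\<And>f. poly (J a (r * f)) b = 0"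
  shows "a = b"
proof (rule ccontr)
  assume "a \<noteq> b"
  define d where "d = [:-a, 1:]"
  have d: "pderiv d = 1" "poly d a = 0" "poly d b = b - a" "order b d = 0" "d \<noteq> 0"
    using \<open>a \<noteq> b\<close> by (simp_all add: d_def pderiv_pCons order_0I)
  have no_r: False if "r \<noteq> 0" "\<And>f. poly (J a (r * f)) b = 0" "order b r = k" for r :: "'a poly" and k
    using that
  proof (induction k arbitrary: r)
    case 0
    have "d * r\<^sup>2 = J a (r * (r + 2 * d * pderiv r))"
      by (rule eq_J) (auto simp: power2_eq_square pderiv_mult d algebra_simps)
    then have "poly (d * r\<^sup>2) b = 0"
      using "0.prems"(2) by simp
    moreover have "poly r b \<noteq> 0"
      using "0.prems" order_root by blast
    ultimately show False
      using \<open>a \<noteq> b\<close> by (simp add: d)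
  next
    case (Suc k)
    have rb: "poly r b = 0"
      using Suc.prems order_root by (metis nat.distinct(1))
    have dr: "pderiv r \<noteq> 0"
    proof
      assume "pderiv r = 0"
      then obtain c where "r = [:c:]"
        by (metis degree_eq_zeroE pderiv_eq_0_iff)
      with rb Suc.prems(1) show False by simp
    qed
    have *: "order b (d * pderiv r) = k"
    proof -
      have "order b r = Suc (order b (pderiv r))"
        using order_pderiv[OF Suc.prems(1) rb] .
      moreover have "d * pderiv r \<noteq> 0"
        using dr d by simp
      ultimately show ?thesis
        using order_mult[of d "pderiv r" b] Suc.prems d by simp
    qed
    have "poly (J a (d * pderiv r * f)) b = 0" for f
    proof -
      have "d * r * f = J a (d * pderiv r * f + r * (f + d * pderiv f))"
        by (rule eq_J) (auto simp: pderiv_mult d algebra_simps)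
      then have "poly (d * r * f) b =
          poly (J a (d * pderiv r * f)) b + poly (J a (r * (f + d * pderiv f))) b"
        by (simp only: J_add poly_add)
      then show ?thesis
        using Suc.prems(2) rb by simp
    qed
    with * dr d show False
      by (intro Suc.IH[of "d * pderiv r"]) auto
  qed
  show False using no_r[OF assms refl] .
qed

lemma bij_betw_RB_ops:
  "bij_betw (\<lambda>(a, r). J a \<circ> mult_op r) (UNIV \<times> {r. r \<noteq> 0})
     (RB_ops :: ('a::field_char_0 poly \<Rightarrow> 'a poly) set)"
proof -
  have "a = b \<and> r = s" if eq: "J a \<circ> mult_op r = J b \<circ> mult_op s" and "r \<noteq> 0" for a b and r s :: "'a poly"
  proof -
    have J: "J a (r * f) = J b (s * f)" for f
      using fun_cong[OF eq, of f] by (simp add: mult_op_def)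
    have "r = s"
      using arg_cong[OF J[of 1], of pderiv] by (simp add: pderiv_J)
    moreover have "a = b"
      using \<open>r \<noteq> 0\<close> by (rule J_eq_0_imp_eq) (simp add: J poly_J)
    ultimately show ?thesis by simp
  qed
  then show ?thesis
    by (fastforce simp: bij_betw_def inj_on_def RB_ops_def)
qed

section \<open>Polynomial and regular functions\<close>

lemma poly_fun_sum:
  assumes "\<And>k. k \<in> A \<Longrightarrow> p k \<in> poly_fun I"
  shows "(\<lambda>x. \<Sum>k\<in>A. p k x) \<in> poly_fun I"
  using assms
proof (induction A rule: infinite_finite_induct)
  case (insert k A)
  then show ?case by (auto intro: poly_fun.add)
qed (use poly_fun.const[of 0] in auto)

lemma poly_fun_power:
  assumes "p \<in> poly_fun I"
  shows "(\<lambda>x. p x ^ n) \<in> poly_fun I"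
proof (induction n)
  case 0
  then show ?case using poly_fun.const[of 1] by simp
qed (use assms in \<open>auto intro: poly_fun.mult\<close>)

text \<open>
  Both projections of a product, in coordinates, are instances of \<open>z \<mapsto> z \<circ> h\<close>, with \<open>h\<close> one of the
  injections into the disjoint sum of the index types.
\<close>

lemma poly_fun_reindex:
  assumes "p \<in> poly_fun I" "h ` I \<subseteq> K"
  shows "(\<lambda>z. p (z \<circ> h)) \<in> poly_fun K"
  using assms by (induction) (auto intro: poly_fun.intros)

lemma poly_fun_rational:
  assumes "p \<in> poly_fun I" "range x \<subseteq> range to_ac"
  shows "p x \<in> range to_ac"
  using assms
proof (induction)
  case (add p q)
  then show ?case by (auto simp flip: to_ac_add)
next
  case (mult p q)
  then show ?case by (auto simp flip: to_ac_mult)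
qed auto

lemma regular_fun_cong:
  assumes "\<And>x. x \<in> V \<Longrightarrow> f x = g x"
  shows "regular_fun I V f \<longleftrightarrow> regular_fun I V g"
  using assms by (simp add: regular_fun_def)

lemma regular_fun_poly_fun:
  assumes "p \<in> poly_fun I"
  shows "regular_fun I V p"
  unfolding regular_fun_def
  by (intro ballI bexI[of _ p] bexI[of _ "\<lambda>x. to_ac 1"] assms poly_fun.const) simp

lemma regular_fun_reindex:
  assumes f: "regular_fun I V f" and h: "h ` I \<subseteq> K" and W: "\<And>z. z \<in> W \<Longrightarrow> z \<circ> h \<in> V"
  shows "regular_fun K W (\<lambda>z. f (z \<circ> h))"
  unfolding regular_fun_def
proof
  fix z assume "z \<in> W"
  then obtain p q where pq: "p \<in> poly_fun I" "q \<in> poly_fun I" "q (z \<circ> h) \<noteq> 0"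
      "\<And>y. y \<in> V \<Longrightarrow> q y \<noteq> 0 \<Longrightarrow> f y = p y / q y"
    using f W[OF \<open>z \<in> W\<close>] unfolding regular_fun_def by blast
  have "\<forall>y\<in>W. q (y \<circ> h) \<noteq> 0 \<longrightarrow> f (y \<circ> h) = p (y \<circ> h) / q (y \<circ> h)"
    using pq(4) W by simp
  with pq(3) show "\<exists>p\<in>poly_fun K. \<exists>q\<in>poly_fun K. q z \<noteq> 0 \<and> (\<forall>y\<in>W. q y \<noteq> 0 \<longrightarrow> f (y \<circ> h) = p y / q y)"
    using poly_fun_reindex[OF pq(1) h] poly_fun_reindex[OF pq(2) h]
    by (intro bexI[where x = "\<lambda>z. p (z \<circ> h)"] bexI[where x = "\<lambda>z. q (z \<circ> h)"] conjI) simp_all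
qed

text \<open>
  All polynomials involved have coefficients in the base field. This is what carries rationality of
  a point from one stage of an ind-variety to the next.
\<close>

lemma regular_fun_rational:
  assumes f: "regular_fun I V f" and x: "x \<in> V" "range x \<subseteq> range to_ac"
  shows "f x \<in> range to_ac"
proof -
  obtain p q where pq: "p \<in> poly_fun I" "q \<in> poly_fun I" "f x = p x / q x"
    using f x(1) unfolding regular_fun_def by meson
  then obtain b c where "p x = to_ac b" "q x = to_ac c"
    using poly_fun_rational x(2) by (metis rangeE)
  then have "f x = to_ac (b / c)"
    using pq by simp
  then show ?thesis by (simp only: rangeI)
qed

section \<open>Algebraic sets and closed embeddings\<close>

lemma algebraic_set_affine_space: "algebraic_set I (affine_space I)"
  unfolding algebraic_set_def by (rule exI[of _ "{}"]) auto

lemma algebraic_set_empty: "algebraic_set I {}"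
  unfolding algebraic_set_def
  by (rule exI[of _ "{\<lambda>x. to_ac 1}"]) (use poly_fun.const[of 1] in auto)

lemma algebraic_set_Int:
  assumes "algebraic_set I Y" "algebraic_set I Z"
  shows "algebraic_set I (Y \<inter> Z)"
proof -
  obtain P where "P \<subseteq> poly_fun I" "Y = {x \<in> affine_space I. \<forall>p\<in>P. p x = 0}"
    using assms(1) unfolding algebraic_set_def by blast
  moreover obtain Q where "Q \<subseteq> poly_fun I" "Z = {x \<in> affine_space I. \<forall>p\<in>Q. p x = 0}"
    using assms(2) unfolding algebraic_set_def by blast
  ultimately show ?thesis
    unfolding algebraic_set_def by (intro exI[of _ "P \<union> Q"]) auto
qed

lemma algebraic_set_Un:
  assumes "algebraic_set I Y" "algebraic_set I Z"
  shows "algebraic_set I (Y \<union> Z)"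
proof -
  obtain P where "P \<subseteq> poly_fun I" and Y: "Y = {x \<in> affine_space I. \<forall>p\<in>P. p x = 0}"
    using assms(1) unfolding algebraic_set_def by blast
  moreover obtain Q where "Q \<subseteq> poly_fun I" and Z: "Z = {x \<in> affine_space I. \<forall>p\<in>Q. p x = 0}"
    using assms(2) unfolding algebraic_set_def by blast
  moreover define PQ where "PQ = (\<lambda>(p, q) x. p x * q x) ` (P \<times> Q)"
  ultimately have "PQ \<subseteq> poly_fun I"
    by (auto intro: poly_fun.mult)
  moreover have "(\<forall>h\<in>PQ. h x = 0) \<longleftrightarrow> (\<forall>p\<in>P. p x = 0) \<or> (\<forall>q\<in>Q. q x = 0)" for x
    unfolding PQ_def by auto
  then have "Y \<union> Z = {x \<in> affine_space I. \<forall>h\<in>PQ. h x = 0}"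
    using Y Z by blast
  ultimately show ?thesis
    unfolding algebraic_set_def by blast
qed

text \<open>
  The equation \<open>h -` K = I\<close> says that coordinates outside \<open>I\<close> are read from coordinates outside
  \<open>K\<close>, so that \<open>z \<mapsto> z \<circ> h\<close> maps the affine space over \<open>K\<close> into the one over \<open>I\<close>.
\<close>

lemma algebraic_set_reindex:
  assumes Z: "algebraic_set I Z" and h: "h -` K = I"
  shows "algebraic_set K {z \<in> affine_space K. z \<circ> h \<in> Z}"
proof -
  obtain P where P: "P \<subseteq> poly_fun I" "Z = {x \<in> affine_space I. \<forall>p\<in>P. p x = 0}"
    using Z unfolding algebraic_set_def by blast
  have "(\<lambda>z. p (z \<circ> h)) \<in> poly_fun K" if "p \<in> P" for p
    using P(1) h that by (intro poly_fun_reindex[of _ I]) auto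
  moreover have "z \<circ> h \<in> affine_space I" if "z \<in> affine_space K" for z :: "_ \<Rightarrow> 'b alg_closure"
    using that h by (auto simp: affine_space_def)
  ultimately show ?thesis
    unfolding algebraic_set_def P(2) by (intro exI[of _ "(\<lambda>p z. p (z \<circ> h)) ` P"]) auto
qed

lemma algebraic_set_sub_affine_space:
  assumes "I \<subseteq> K"
  shows "algebraic_set K (affine_space I)"
  unfolding algebraic_set_def
  by (rule exI[of _ "(\<lambda>i x. x i) ` (K - I)"])
    (use assms in \<open>auto simp: affine_space_def intro: poly_fun.coord\<close>)

lemma quasi_affine_variety_subset:
  assumes "quasi_affine_variety I V"
  shows "V \<subseteq> affine_space I"
  using assms unfolding quasi_affine_variety_def algebraic_set_def by auto

lemma quasi_affine_variety_Diff:
  assumes "finite I" "algebraic_set I Z"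
  shows "quasi_affine_variety I (affine_space I - Z)"
  using assms algebraic_set_affine_space unfolding quasi_affine_variety_def by blast

lemma quasi_affine_variety_affine_space:
  assumes "finite I"
  shows "quasi_affine_variety I (affine_space I)"
  using quasi_affine_variety_Diff[OF assms algebraic_set_empty] by simp

lemma variety_morphism_cong:
  assumes "\<And>x. x \<in> V \<Longrightarrow> f x = g x"
  shows "variety_morphism I V K W f \<longleftrightarrow> variety_morphism I V K W g"
proof -
  have "f ` V = g ` V"
    using assms by (rule image_cong[OF refl])
  moreover have "regular_fun I V (\<lambda>x. f x k) \<longleftrightarrow> regular_fun I V (\<lambda>x. g x k)" for k
    using assms by (intro regular_fun_cong) simp
  ultimately show ?thesis
    by (simp add: variety_morphism_def)
qed

text \<open>
  An explicit left inverse \<open>g\<close> replaces the choice operator hidden in \<^const>\<open>inv_into\<close>.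
\<close>

lemma closed_embeddingI:
  assumes f: "variety_morphism I V K W f"
    and g: "variety_morphism K (f ` V) I V g" "\<And>x. x \<in> V \<Longrightarrow> g (f x) = x"
    and Z: "algebraic_set K Z" "f ` V = W \<inter> Z"
  shows "closed_embedding I V K W f"
proof -
  have inj: "inj_on f V"
    using g(2) by (intro inj_on_inverseI[where g = g])
  have "inv_into V f y = g y" if "y \<in> f ` V" for y
    using that g(2) inj by (auto simp: inv_into_f_f)
  then have "variety_morphism K (f ` V) I V (inv_into V f)"
    using g(1) variety_morphism_cong[of "f ` V" "inv_into V f" g K I V] by simp
  then show ?thesis
    using f inj Z unfolding closed_embedding_def by blast
qed

text \<open>
  Both spaces of polynomials have transition maps of this form: the next stage has one more
  coordinate, and the previous stage is where it vanishes. The map \<open>f\<close> is arbitrary off \<open>V\<close>,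
  because a transition map read in charts is determined only on the image of the chart.
\<close>

lemma closed_embedding_inclusion:
  assumes IK: "I \<subseteq> K" and V: "V = W \<inter> affine_space I" and f: "\<And>x. x \<in> V \<Longrightarrow> f x = x"
  shows "closed_embedding I V K W f"
proof (rule closed_embeddingI[where g = id])
  have fV: "f ` V = V" using f by simp
  have "regular_fun I V (\<lambda>x. x k)" for k
  proof (cases "k \<in> I")
    case True
    then show ?thesis by (intro regular_fun_poly_fun poly_fun.coord)
  next
    case False
    then have "x k = to_ac 0" if "x \<in> V" for x
      using that V by (auto simp: affine_space_def)
    then show ?thesis
      using regular_fun_cong[of V "\<lambda>x. x k" "\<lambda>x. to_ac 0" I]
        regular_fun_poly_fun[OF poly_fun.const] by blast
  qed
  then have "regular_fun I V (\<lambda>x. f x k)" for k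
    using regular_fun_cong[of V "\<lambda>x. f x k" "\<lambda>x. x k" I] f by simp
  then show "variety_morphism I V K W f"
    using fV V by (simp add: variety_morphism_def)
  show "variety_morphism K (f ` V) I V id"
    using IK by (auto simp: variety_morphism_def fV intro!: regular_fun_poly_fun poly_fun.coord)
  show "algebraic_set K (affine_space I)"
    using IK by (rule algebraic_set_sub_affine_space)
  show "f ` V = W \<inter> affine_space I"
    using fV V by simp
  show "id (f x) = x" if "x \<in> V" for x
    using f that by simp
qed

section \<open>Products\<close>

no_notation set_add (infixl \<open><+>\<index>\<close> 60)
notation Sum_Type.Plus (infixr \<open><+>\<close> 65)

definition prod_pts :: "('i \<Rightarrow> 'c) set \<Rightarrow> ('j \<Rightarrow> 'c) set \<Rightarrow> ('i + 'j \<Rightarrow> 'c) set"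
  where "prod_pts V W = {z. z \<circ> Inl \<in> V \<and> z \<circ> Inr \<in> W}"

lemma case_sum_o_Inl [simp]: "case_sum x y \<circ> Inl = x"
  and case_sum_o_Inr [simp]: "case_sum x y \<circ> Inr = y"
  by auto

lemma case_sum_Inl_Inr [simp]: "case_sum (z \<circ> Inl) (z \<circ> Inr) = z"
  by (rule ext) (simp split: sum.split)

lemma prod_pts_eq_image: "prod_pts V W = (\<lambda>(x, y). case_sum x y) ` (V \<times> W)"
  by (force simp: prod_pts_def image_iff intro: bexI[of _ "_ \<circ> Inl"] bexI[of _ "_ \<circ> Inr"])

lemma affine_space_Plus: "affine_space (I <+> K) = prod_pts (affine_space I) (affine_space K)"
  unfolding prod_pts_def affine_space_def by (auto simp: split_sum_all)

lemma vimage_Inl_Plus: "Inl -` (I <+> K) = I" and vimage_Inr_Plus: "Inr -` (I <+> K) = K"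
  by auto

lemma regular_fun_Inl:
  assumes "regular_fun I V f" "U \<subseteq> prod_pts V W"
  shows "regular_fun (I <+> K) U (\<lambda>z. f (z \<circ> Inl))"
  using assms by (intro regular_fun_reindex[of I V]) (auto simp: prod_pts_def)

lemma regular_fun_Inr:
  assumes "regular_fun K W f" "U \<subseteq> prod_pts V W"
  shows "regular_fun (I <+> K) U (\<lambda>z. f (z \<circ> Inr))"
  using assms by (intro regular_fun_reindex[of K W]) (auto simp: prod_pts_def)

lemma variety_morphism_prod:
  assumes f: "variety_morphism I V I' V' f" and g: "variety_morphism K W K' W' g"
  shows "variety_morphism (I <+> K) (prod_pts V W) (I' <+> K') (prod_pts V' W')
           (\<lambda>z. case_sum (f (z \<circ> Inl)) (g (z \<circ> Inr)))"
  unfolding variety_morphism_def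
proof (intro conjI ballI)
  show "(\<lambda>z. case_sum (f (z \<circ> Inl)) (g (z \<circ> Inr))) ` prod_pts V W \<subseteq> prod_pts V' W'"
    using f g by (auto simp: variety_morphism_def prod_pts_def)
next
  fix k assume "k \<in> I' <+> K'"
  then show "regular_fun (I <+> K) (prod_pts V W) (\<lambda>z. case_sum (f (z \<circ> Inl)) (g (z \<circ> Inr)) k)"
  proof
    fix i assume "i \<in> I'" "k = Inl i"
    then show ?thesis
      using f regular_fun_Inl[of I V "\<lambda>x. f x i" "prod_pts V W" W K] by (simp add: variety_morphism_def)
  next
    fix j assume "j \<in> K'" "k = Inr j"
    then show ?thesis
      using g regular_fun_Inr[of K W "\<lambda>y. g y j" "prod_pts V W" V I] by (simp add: variety_morphism_def)
  qed
qed

lemma algebraic_set_prod: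
  assumes "algebraic_set I Y" "algebraic_set K Z"
  shows "algebraic_set (I <+> K) (prod_pts Y Z)"
proof -
  have sub: "Y \<subseteq> affine_space I" "Z \<subseteq> affine_space K"
    using assms by (auto simp: algebraic_set_def)
  have "algebraic_set (I <+> K) ({z \<in> affine_space (I <+> K). z \<circ> Inl \<in> Y} \<inter>
      {z \<in> affine_space (I <+> K). z \<circ> Inr \<in> Z})"
    using algebraic_set_reindex[OF assms(1) vimage_Inl_Plus] algebraic_set_reindex[OF assms(2) vimage_Inr_Plus]
    by (rule algebraic_set_Int)
  also have "{z \<in> affine_space (I <+> K). z \<circ> Inl \<in> Y} \<inter> {z \<in> affine_space (I <+> K). z \<circ> Inr \<in> Z}
      = prod_pts Y Z"
    using sub by (auto simp: affine_space_Plus prod_pts_def)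
  finally show ?thesis .
qed

text \<open>
  \<open>(Y - Y') \<times> (Z - Z')\<close> is \<open>Y \<times> Z\<close> without \<open>Y' \<times> \<A>\<close> and \<open>\<A> \<times> Z'\<close>, where \<open>\<A>\<close> stands for an affine space.
\<close>

lemma quasi_affine_variety_prod:
  assumes V: "quasi_affine_variety I V" and W: "quasi_affine_variety K W"
  shows "quasi_affine_variety (I <+> K) (prod_pts V W)"
proof -
  obtain Y Y' where Y: "algebraic_set I Y" "algebraic_set I Y'" "V = Y - Y'"
    using V unfolding quasi_affine_variety_def by blast
  obtain Z Z' where Z: "algebraic_set K Z" "algebraic_set K Z'" "W = Z - Z'"
    using W unfolding quasi_affine_variety_def by blast
  have "prod_pts V W = prod_pts Y Z - (prod_pts Y' (affine_space K) \<union> prod_pts (affine_space I) Z')"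
    using Y Z by (auto simp: prod_pts_def algebraic_set_def)
  moreover have "algebraic_set (I <+> K) (prod_pts Y' (affine_space K) \<union> prod_pts (affine_space I) Z')"
    using Y Z by (intro algebraic_set_Un algebraic_set_prod algebraic_set_affine_space)
  ultimately show ?thesis
    using algebraic_set_prod[OF Y(1) Z(1)] V W unfolding quasi_affine_variety_def by (metis finite_Plus)
qed

lemma closed_embedding_prod:
  assumes f: "closed_embedding I V I' V' f" and g: "closed_embedding K W K' W' g"
    and F: "\<And>x y. x \<in> V \<Longrightarrow> y \<in> W \<Longrightarrow> F (case_sum x y) = case_sum (f x) (g y)"
  shows "closed_embedding (I <+> K) (prod_pts V W) (I' <+> K') (prod_pts V' W') F"
proof -
  obtain Y where Y: "algebraic_set I' Y" "f ` V = V' \<inter> Y"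
    using f unfolding closed_embedding_def by blast
  obtain Z where Z: "algebraic_set K' Z" "g ` W = W' \<inter> Z"
    using g unfolding closed_embedding_def by blast
  have F': "F z = case_sum (f (z \<circ> Inl)) (g (z \<circ> Inr))" if "z \<in> prod_pts V W" for z
    using F[of "z \<circ> Inl" "z \<circ> Inr"] that by (simp add: prod_pts_def)
  have img: "F ` prod_pts V W = prod_pts (f ` V) (g ` W)"
    by (force simp: prod_pts_eq_image F)
  show ?thesis
  proof (rule closed_embeddingI)
    show "variety_morphism (I <+> K) (prod_pts V W) (I' <+> K') (prod_pts V' W') F"
    proof -
      have "variety_morphism (I <+> K) (prod_pts V W) (I' <+> K') (prod_pts V' W')
          (\<lambda>z. case_sum (f (z \<circ> Inl)) (g (z \<circ> Inr)))"
        using f g by (intro variety_morphism_prod) (simp_all add: closed_embedding_def)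
      then show ?thesis
        by (subst variety_morphism_cong[OF F'])
    qed
    show "variety_morphism (I' <+> K') (F ` prod_pts V W) (I <+> K) (prod_pts V W)
        (\<lambda>z. case_sum (inv_into V f (z \<circ> Inl)) (inv_into W g (z \<circ> Inr)))"
      unfolding img using f g by (intro variety_morphism_prod) (auto simp: closed_embedding_def)
    show "case_sum (inv_into V f (F z \<circ> Inl)) (inv_into W g (F z \<circ> Inr)) = z"
      if "z \<in> prod_pts V W" for z
    proof -
      have "z \<circ> Inl \<in> V" "z \<circ> Inr \<in> W"
        using that by (auto simp: prod_pts_def)
      then show ?thesis
        using that f g by (simp add: F' closed_embedding_def)
    qed
    show "algebraic_set (I' <+> K') (prod_pts Y Z)"
      using Y(1) Z(1) by (rule algebraic_set_prod)
    show "F ` prod_pts V W = prod_pts V' W' \<inter> prod_pts Y Z"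
      unfolding img Y(2) Z(2) by (auto simp: prod_pts_def)
  qed
qed

section \<open>Ind-varieties\<close>

lemma in_charts_chart:
  assumes "inj_on (chart A n) (stage A n)" "x \<in> stage A n"
  shows "in_charts A n B m \<Phi> (chart A n x) = chart B m (\<Phi> x)"
  using assms by (simp add: in_charts_def)

lemma quasi_affine_ind_varietyD:
  assumes "quasi_affine_ind_variety S A"
  shows "inj_on (chart A n) (stage A n)"
    and "quasi_affine_variety (coords A n) (chart A n ` stage A n)"
    and "stage A n \<subseteq> stage A (Suc n)"
    and "closed_embedding (coords A n) (chart A n ` stage A n)
           (coords A (Suc n)) (chart A (Suc n) ` stage A (Suc n)) (in_charts A n A (Suc n) id)"
  using assms unfolding quasi_affine_ind_variety_def by blast+

lemma quasi_affine_ind_variety_pt: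
  assumes "quasi_affine_ind_variety S A"
  shows "bij_betw (pt A) S (rational_points A)"
  using assms unfolding quasi_affine_ind_variety_def by blast

text \<open>
  Rationality is tested in the chart of a stage. It persists at later stages: the coordinates in
  the next chart are regular functions over the base field of those in the current one, and they
  vanish outside the coordinate set of the next chart.
\<close>

lemma rational_chart_mono:
  assumes A: "quasi_affine_ind_variety S A"
    and "n \<le> m" "x \<in> stage A n" "range (chart A n x) \<subseteq> range to_ac"
  shows "x \<in> stage A m \<and> range (chart A m x) \<subseteq> range to_ac"
  using \<open>n \<le> m\<close>
proof (induction m rule: dec_induct)
  case base
  then show ?case using assms by simp
next
  case (step m)
  note A' = quasi_affine_ind_varietyD[OF A, of m]
  note IH = step.IH
  have x: "x \<in> stage A (Suc m)"
    using A'(3) IH by blast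
  have "chart A (Suc m) x j \<in> range to_ac" for j
  proof (cases "j \<in> coords A (Suc m)")
    case True
    then have "regular_fun (coords A m) (chart A m ` stage A m) (\<lambda>y. in_charts A m A (Suc m) id y j)"
      using A'(4) by (simp add: closed_embedding_def variety_morphism_def)
    then have "in_charts A m A (Suc m) id (chart A m x) j \<in> range to_ac"
      by (rule regular_fun_rational) (use IH in simp_all)
    then show ?thesis
      using IH by (simp add: in_charts_chart[OF A'(1)])
  next
    case False
    then have "chart A (Suc m) x j = to_ac 0"
      using quasi_affine_variety_subset[OF quasi_affine_ind_varietyD(2)[OF A, of "Suc m"]] x
      by (auto simp: affine_space_def)
    then show ?thesis by blast
  qed
  then show ?case using x by blast
qed

lemma ind_prod_simps [simp]:
  "stage (A \<times>\<^sub>i B) n = stage A n \<times> stage B n"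
  "coords (A \<times>\<^sub>i B) n = coords A n <+> coords B n"
  "chart (A \<times>\<^sub>i B) n (x, y) = case_sum (chart A n x) (chart B n y)"
  "pt (A \<times>\<^sub>i B) = map_prod (pt A) (pt B)"
  by (simp_all add: ind_prod_def Plus_def)

lemma range_case_sum: "range (case_sum x y) = range x \<union> range y"
  unfolding UNIV_sum by (simp add: image_Un image_image)

lemma rational_points_prod:
  assumes "quasi_affine_ind_variety S A" "quasi_affine_ind_variety T B"
  shows "rational_points (A \<times>\<^sub>i B) = rational_points A \<times> rational_points B"
proof -
  have "(x, y) \<in> rational_points (A \<times>\<^sub>i B)" if "x \<in> rational_points A" "y \<in> rational_points B" for x y
  proof -
    obtain n m where "x \<in> stage A n" "range (chart A n x) \<subseteq> range to_ac"
        "y \<in> stage B m" "range (chart B m y) \<subseteq> range to_ac"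
      using \<open>x \<in> rational_points A\<close> \<open>y \<in> rational_points B\<close> unfolding rational_points_def by blast
    then have "x \<in> stage A (max n m) \<and> range (chart A (max n m) x) \<subseteq> range to_ac"
        "y \<in> stage B (max n m) \<and> range (chart B (max n m) y) \<subseteq> range to_ac"
      using rational_chart_mono[OF assms(1), of n "max n m"]
        rational_chart_mono[OF assms(2), of m "max n m"] by auto
    then have "(x, y) \<in> stage (A \<times>\<^sub>i B) (max n m) \<and> range (chart (A \<times>\<^sub>i B) (max n m) (x, y)) \<subseteq> range to_ac"
      by (simp add: range_case_sum)
    then show ?thesis
      unfolding rational_points_def by blast
  qed
  moreover have "x \<in> rational_points A \<and> y \<in> rational_points B" if xy: "(x, y) \<in> rational_points (A \<times>\<^sub>i B)" for x y
  proof -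
    obtain n where "(x, y) \<in> stage (A \<times>\<^sub>i B) n" "range (chart (A \<times>\<^sub>i B) n (x, y)) \<subseteq> range to_ac"
      using xy unfolding rational_points_def by blast
    then have "x \<in> stage A n \<and> range (chart A n x) \<subseteq> range to_ac"
        "y \<in> stage B n \<and> range (chart B n y) \<subseteq> range to_ac"
      by (simp_all add: range_case_sum)
    then show ?thesis
      unfolding rational_points_def by blast
  qed
  ultimately show ?thesis by auto
qed

lemma chart_image_prod:
  "chart (A \<times>\<^sub>i B) n ` (stage A n \<times> stage B n) = prod_pts (chart A n ` stage A n) (chart B n ` stage B n)"
  by (force simp: prod_pts_eq_image)

lemma quasi_affine_ind_variety_prod:
  assumes A: "quasi_affine_ind_variety S A" and B: "quasi_affine_ind_variety T B"
  shows "quasi_affine_ind_variety (S \<times> T) (A \<times>\<^sub>i B)"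
  unfolding quasi_affine_ind_variety_def
proof (intro conjI allI)
  fix n
  note A' = quasi_affine_ind_varietyD[OF A, of n] and B' = quasi_affine_ind_varietyD[OF B, of n]
  show inj: "inj_on (chart (A \<times>\<^sub>i B) n) (stage (A \<times>\<^sub>i B) n)"
  proof (rule inj_onI, clarsimp)
    fix x y x' y'
    assume "x \<in> stage A n" "y \<in> stage B n" "x' \<in> stage A n" "y' \<in> stage B n"
      and eq: "case_sum (chart A n x) (chart B n y) = case_sum (chart A n x') (chart B n y')"
    moreover have "chart A n x = chart A n x'" "chart B n y = chart B n y'"
      using arg_cong[OF eq, of "\<lambda>z. z \<circ> Inl"] arg_cong[OF eq, of "\<lambda>z. z \<circ> Inr"] by simp_all
    ultimately show "x = x' \<and> y = y'"
      using A'(1) B'(1) by (auto dest: inj_onD)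
  qed
  show "quasi_affine_variety (coords (A \<times>\<^sub>i B) n) (chart (A \<times>\<^sub>i B) n ` stage (A \<times>\<^sub>i B) n)"
    using quasi_affine_variety_prod[OF A'(2) B'(2)] by (simp add: chart_image_prod)
  show "stage (A \<times>\<^sub>i B) n \<subseteq> stage (A \<times>\<^sub>i B) (Suc n)"
    using A'(3) B'(3) by auto
  have "in_charts (A \<times>\<^sub>i B) n (A \<times>\<^sub>i B) (Suc n) id (case_sum (chart A n x) (chart B n y)) =
      case_sum (in_charts A n A (Suc n) id (chart A n x)) (in_charts B n B (Suc n) id (chart B n y))"
    if "x \<in> stage A n" "y \<in> stage B n" for x y
    using in_charts_chart[OF inj, of "(x, y)" "A \<times>\<^sub>i B" "Suc n" id] that
    by (simp add: in_charts_chart[OF A'(1)] in_charts_chart[OF B'(1)])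
  then show "closed_embedding (coords (A \<times>\<^sub>i B) n) (chart (A \<times>\<^sub>i B) n ` stage (A \<times>\<^sub>i B) n)
      (coords (A \<times>\<^sub>i B) (Suc n)) (chart (A \<times>\<^sub>i B) (Suc n) ` stage (A \<times>\<^sub>i B) (Suc n))
      (in_charts (A \<times>\<^sub>i B) n (A \<times>\<^sub>i B) (Suc n) id)"
    using A'(4) B'(4) by (auto simp: chart_image_prod intro!: closed_embedding_prod)
next
  show "bij_betw (pt (A \<times>\<^sub>i B)) (S \<times> T) (rational_points (A \<times>\<^sub>i B))"
    using quasi_affine_ind_variety_pt[OF A] quasi_affine_ind_variety_pt[OF B]
    by (simp add: rational_points_prod[OF A B] bij_betw_map_prod)
qed

text \<open>
  Transport changes only how the rational points are labelled.
\<close>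

lemma quasi_affine_ind_variety_transport:
  assumes A: "quasi_affine_ind_variety S A" and \<phi>: "bij_betw \<phi> S T"
  shows "quasi_affine_ind_variety T (ind_transport S \<phi> A)"
proof -
  have "bij_betw (pt A \<circ> inv_into S \<phi>) T (rational_points A)"
    using bij_betw_trans[OF bij_betw_inv_into[OF \<phi>] quasi_affine_ind_variety_pt[OF A]] .
  then show ?thesis
    using A by (simp add: quasi_affine_ind_variety_def ind_transport_def in_charts_def rational_points_def)
qed

section \<open>Spaces of polynomials as ind-varieties\<close>

lemma affine_space_UNIV: "affine_space UNIV = UNIV"
  by (simp add: affine_space_def)

lemma quasi_affine_ind_variety_line:
  "quasi_affine_ind_variety UNIV (ind_line :: (_, _, _, 'a::field) ind_structure)"
proof -
  have img: "(\<lambda>a (_::unit). a) ` UNIV = (UNIV :: (unit \<Rightarrow> 'a alg_closure) set)"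
    by (auto simp: fun_eq_iff image_iff)
  have inj: "inj (\<lambda>a (_::unit). a :: 'a alg_closure)"
    by (auto simp: inj_on_def fun_eq_iff)
  have "in_charts ind_line n (ind_line :: (_, _, _, 'a) ind_structure) m id x = x" for n m x
  proof -
    have "x = chart ind_line n (x ())"
      by (auto simp: ind_line_def)
    then show ?thesis
      using in_charts_chart[of "ind_line :: (_, _, _, 'a) ind_structure" n "x ()" ind_line m id] inj by (simp add: ind_line_def)
  qed
  then show ?thesis
    using inj_to_ac quasi_affine_variety_affine_space[of "UNIV :: unit set"]
    by (auto simp: quasi_affine_ind_variety_def ind_line_def img inj rational_points_def bij_betw_def
        affine_space_UNIV intro!: closed_embedding_inclusion)
qed

lemma coeff_image_degree_le:
  "Polynomial.coeff ` {p. degree p \<le> d} = (affine_space {..d} :: (nat \<Rightarrow> 'a::field alg_closure) set)"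
proof
  show "Polynomial.coeff ` {p. degree p \<le> d} \<subseteq> (affine_space {..d} :: (nat \<Rightarrow> 'a alg_closure) set)"
    by (auto simp: affine_space_def coeff_eq_0)
next
  show "(affine_space {..d} :: (nat \<Rightarrow> 'a alg_closure) set) \<subseteq> Polynomial.coeff ` {p. degree p \<le> d}"
  proof
    fix x :: "nat \<Rightarrow> 'a alg_closure" assume x: "x \<in> affine_space {..d}"
    define p where "p = (\<Sum>i\<le>d. Polynomial.monom (x i) i)"
    have "Polynomial.coeff p = x"
      using x by (auto simp: p_def coeff_sum affine_space_def fun_eq_iff)
    moreover have "degree p \<le> d"
      using x calculation by (auto simp: degree_le affine_space_def)
    ultimately show "x \<in> Polynomial.coeff ` {p. degree p \<le> d}" by blast
  qed
qed

lemma coeff_image_degree_le_nonzero: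
  "Polynomial.coeff ` {p. p \<noteq> 0 \<and> degree p \<le> d} = (affine_space {..d} - {\<lambda>_. 0} :: (nat \<Rightarrow> 'a::field alg_closure) set)"
proof -
  have "{p :: 'a alg_closure poly. p \<noteq> 0 \<and> degree p \<le> d} = {p. degree p \<le> d} - {0}" by auto
  also have "Polynomial.coeff ` ({p. degree p \<le> d} - {0}) =
      Polynomial.coeff ` {p. degree p \<le> d} - Polynomial.coeff ` {0 :: 'a alg_closure poly}"
    by (rule image_set_diff) (simp add: inj_def coeff_inject)
  also have "Polynomial.coeff ` {0 :: 'a alg_closure poly} = {\<lambda>_. 0}"
    by (simp add: fun_eq_iff)
  finally show ?thesis
    by (simp only: coeff_image_degree_le)
qed

lemma range_map_poly_to_ac: "range (map_poly to_ac) = {p. range (Polynomial.coeff p) \<subseteq> range to_ac}"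
proof safe
  fix p :: "'a alg_closure poly" assume p: "range (Polynomial.coeff p) \<subseteq> range to_ac"
  have "p = map_poly to_ac (map_poly of_ac p)"
    using p by (intro poly_eqI) (simp add: coeff_map_poly to_ac_of_ac image_subset_iff)
  then show "p \<in> range (map_poly to_ac)" by blast
qed (auto simp: coeff_map_poly)

lemma inj_map_poly_to_ac: "inj (map_poly to_ac)"
  by (rule injI) (simp add: poly_eq_iff coeff_map_poly)

lemma in_charts_coeff:
  assumes "chart A n = Polynomial.coeff" "chart B m = Polynomial.coeff" "y \<in> Polynomial.coeff ` stage A n"
  shows "in_charts A n B m id y = y"
  using assms by (auto simp: in_charts_def inj_on_def coeff_inject inv_into_f_f)

lemma quasi_affine_ind_variety_poly:
  "quasi_affine_ind_variety UNIV (ind_poly :: (_, _, _, 'a::field) ind_structure)"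
  unfolding quasi_affine_ind_variety_def
proof (intro conjI allI)
  fix n
  show "inj_on (chart ind_poly n) (stage (ind_poly :: (_, _, _, 'a) ind_structure) n)"
    by (auto simp: ind_poly_def inj_on_def coeff_inject)
  show "quasi_affine_variety (coords ind_poly n) (chart ind_poly n ` stage (ind_poly :: (_, _, _, 'a) ind_structure) n)"
    by (simp add: ind_poly_def coeff_image_degree_le quasi_affine_variety_affine_space)
  show "stage ind_poly n \<subseteq> stage (ind_poly :: (_, _, _, 'a) ind_structure) (Suc n)"
    by (auto simp: ind_poly_def)
  show "closed_embedding (coords ind_poly n) (chart ind_poly n ` stage ind_poly n)
      (coords ind_poly (Suc n)) (chart ind_poly (Suc n) ` stage ind_poly (Suc n))
      (in_charts ind_poly n (ind_poly :: (_, _, _, 'a) ind_structure) (Suc n) id)"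
  proof (rule closed_embedding_inclusion)
    show "in_charts ind_poly n (ind_poly :: (_, _, _, 'a) ind_structure) (Suc n) id x = x"
      if "x \<in> chart ind_poly n ` stage ind_poly n" for x
      using that by (intro in_charts_coeff) (auto simp: ind_poly_def)
  qed (auto simp: ind_poly_def coeff_image_degree_le, auto simp: affine_space_def)
next
  have "rational_points (ind_poly :: (_, _, _, 'a) ind_structure) = range (map_poly to_ac)"
    by (auto simp: rational_points_def ind_poly_def range_map_poly_to_ac)
  then show "bij_betw (pt ind_poly) UNIV (rational_points (ind_poly :: (_, _, _, 'a) ind_structure))"
    using inj_map_poly_to_ac by (simp add: bij_betw_def ind_poly_def)
qed

lemma quasi_affine_ind_variety_poly_nonzero:
  "quasi_affine_ind_variety {r. r \<noteq> 0} (ind_poly_nonzero :: (_, _, _, 'a::field) ind_structure)"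
  unfolding quasi_affine_ind_variety_def
proof (intro conjI allI)
  fix n
  show "inj_on (chart ind_poly_nonzero n) (stage (ind_poly_nonzero :: (_, _, _, 'a) ind_structure) n)"
    by (auto simp: ind_poly_nonzero_def inj_on_def coeff_inject)
  \<comment> \<open>The origin is closed, being the affine space on no coordinates.\<close>
  have "affine_space {} = {\<lambda>_::nat. 0 :: 'a alg_closure}"
    by (auto simp: affine_space_def)
  moreover have "algebraic_set {..n} (affine_space {} :: (nat \<Rightarrow> 'a alg_closure) set)"
    by (rule algebraic_set_sub_affine_space) simp
  ultimately have "algebraic_set {..n} {\<lambda>_. 0 :: 'a alg_closure}" by simp
  then show "quasi_affine_variety (coords ind_poly_nonzero n)
      (chart ind_poly_nonzero n ` stage (ind_poly_nonzero :: (_, _, _, 'a) ind_structure) n)"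
    by (simp add: ind_poly_nonzero_def coeff_image_degree_le_nonzero quasi_affine_variety_Diff)
  show "stage ind_poly_nonzero n \<subseteq> stage (ind_poly_nonzero :: (_, _, _, 'a) ind_structure) (Suc n)"
    by (auto simp: ind_poly_nonzero_def)
  show "closed_embedding (coords ind_poly_nonzero n) (chart ind_poly_nonzero n ` stage ind_poly_nonzero n)
      (coords ind_poly_nonzero (Suc n)) (chart ind_poly_nonzero (Suc n) ` stage ind_poly_nonzero (Suc n))
      (in_charts ind_poly_nonzero n (ind_poly_nonzero :: (_, _, _, 'a) ind_structure) (Suc n) id)"
  proof (rule closed_embedding_inclusion)
    show "in_charts ind_poly_nonzero n (ind_poly_nonzero :: (_, _, _, 'a) ind_structure) (Suc n) id x = x"
      if "x \<in> chart ind_poly_nonzero n ` stage ind_poly_nonzero n" for x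
      using that by (intro in_charts_coeff) (auto simp: ind_poly_nonzero_def)
  qed (auto simp: ind_poly_nonzero_def coeff_image_degree_le_nonzero, auto simp: affine_space_def)
next
  have "rational_points (ind_poly_nonzero :: (_, _, _, 'a) ind_structure) = range (map_poly to_ac) - {0}"
    by (auto simp: rational_points_def ind_poly_nonzero_def range_map_poly_to_ac)
  also have "\<dots> = map_poly to_ac ` {r. r \<noteq> 0}"
    by (auto simp: poly_eq_iff coeff_map_poly)
  finally show "bij_betw (pt ind_poly_nonzero) {r. r \<noteq> 0}
      (rational_points (ind_poly_nonzero :: (_, _, _, 'a) ind_structure))"
    using inj_on_subset[OF inj_map_poly_to_ac] by (simp add: bij_betw_def ind_poly_nonzero_def)
qed

lemma quasi_affine_ind_variety_RB:
  "quasi_affine_ind_variety (RB_ops :: ('a::field_char_0 poly \<Rightarrow> 'a poly) set) ind_RB"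
  unfolding ind_RB_def
  by (intro quasi_affine_ind_variety_transport quasi_affine_ind_variety_prod
      quasi_affine_ind_variety_line quasi_affine_ind_variety_poly_nonzero bij_betw_RB_ops)

section \<open>The action map\<close>

lemma coeff_J_Suc: "Polynomial.coeff (J a f) (Suc k) = Polynomial.coeff f k / of_nat (Suc k)"
  using arg_cong[OF pderiv_J[of a f], of "\<lambda>p. Polynomial.coeff p k"]
  by (simp add: coeff_pderiv field_simps del: of_nat_Suc)

lemma coeff_J_0:
  assumes "degree f \<le> N"
  shows "Polynomial.coeff (J a f) 0 = (\<Sum>k\<le>N. - (Polynomial.coeff f k / of_nat (Suc k) * a ^ Suc k))"
  by (simp add: J_eq[OF assms] coeff_sum del: of_nat_Suc power_Suc)

lemma degree_J_le: "degree (J a f) \<le> Suc (degree f)"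
proof (rule degree_le, intro allI impI)
  fix i assume "Suc (degree f) < i"
  then show "Polynomial.coeff (J a f) i = 0"
    by (cases i) (auto simp: coeff_J_Suc coeff_eq_0)
qed

lemma map_poly_to_ac_mult: "map_poly to_ac (p * q) = map_poly to_ac p * map_poly to_ac q"
  by (rule poly_eqI) (simp add: coeff_map_poly coeff_mult to_ac_sum)

text \<open>
  Hence the action on points over the closure restricts to the given one on rational points.
\<close>

lemma map_poly_to_ac_J: "map_poly to_ac (J a f) = J (to_ac a) (map_poly to_ac f)"
proof (rule poly_eqI)
  fix k
  have deg: "degree (map_poly to_ac f) \<le> degree f"
    by (rule degree_le) (simp add: coeff_map_poly coeff_eq_0)
  show "Polynomial.coeff (map_poly to_ac (J a f)) k = Polynomial.coeff (J (to_ac a) (map_poly to_ac f)) k"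
    by (cases k) (simp_all add: coeff_map_poly coeff_J_Suc coeff_J_0[of f, OF order_refl] coeff_J_0[OF deg] to_ac_sum
        del: of_nat_Suc power_Suc)
qed

text \<open>
  The \<open>k\<close>-th coefficient of \<open>J a (r * f)\<close>, written in the coordinates \<open>z\<close> of \<open>((a, r), f)\<close> at stage
  \<open>n\<close>. The number \<open>g i\<close> is the \<open>i\<close>-th coefficient of \<open>r * f\<close>; the guards keep the convolution
  within the coordinates of that stage.
\<close>

definition action_coord :: "nat \<Rightarrow> nat \<Rightarrow> ((unit + nat) + nat \<Rightarrow> 'a::field_char_0 alg_closure) \<Rightarrow> 'a alg_closure"
  where "action_coord n k z =
    (let g = (\<lambda>i. \<Sum>j\<le>i. (if j \<le> n then z (Inl (Inr j)) else 0) * (if i - j \<le> n then z (Inr (i - j)) else 0))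
     in case k of
          0 \<Rightarrow> \<Sum>i\<le>2 * n. - (g i / of_nat (Suc i) * z (Inl (Inl ())) ^ Suc i)
        | Suc i \<Rightarrow> g i / of_nat (Suc i))"

lemma action_coord_poly_fun: "action_coord n k \<in> poly_fun ((UNIV <+> {..n}) <+> {..n})"
proof -
  let ?I = "(UNIV <+> {..n}) <+> {..n}"
  define g where "g i z = (\<Sum>j\<le>i. (if j \<le> n then z (Inl (Inr j)) else 0) *
      (if i - j \<le> n then z (Inr (i - j)) else 0))" for i and z :: "(unit + nat) + nat \<Rightarrow> 'a alg_closure"
  have if_coord: "(\<lambda>z. if P then z c else 0) \<in> poly_fun ?I"
    if "P \<Longrightarrow> c \<in> ?I" for P c
    using that poly_fun.coord[of c ?I] poly_fun.const[of 0 ?I] by (cases P) auto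
  have "g i \<in> poly_fun ?I" for i
    unfolding g_def[abs_def] by (intro poly_fun_sum poly_fun.mult if_coord) auto
  then have g_scaled: "(\<lambda>z. g i z / of_nat (Suc i)) \<in> poly_fun ?I" for i
    using poly_fun.mult[OF _ poly_fun.const[of "1 / of_nat (Suc i)" ?I], of "g i"] by simp
  show ?thesis
  proof (cases k)
    case 0
    have "(\<lambda>z. \<Sum>i\<le>2 * n. to_ac (- 1) * (g i z / of_nat (Suc i) * z (Inl (Inl ())) ^ Suc i)) \<in> poly_fun ?I"
      by (intro poly_fun_sum poly_fun.mult[OF poly_fun.const] poly_fun.mult[OF g_scaled] poly_fun_power poly_fun.coord) auto
    then show ?thesis
      by (simp add: action_coord_def[abs_def] 0 g_def del: of_nat_Suc power_Suc)
  next
    case (Suc i)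
    then show ?thesis
      using g_scaled[of i] by (simp add: action_coord_def[abs_def] g_def del: of_nat_Suc)
  qed
qed

lemma coeff_J_mult_eq_action_coord:
  assumes "degree r \<le> n" "degree f \<le> n"
  shows "Polynomial.coeff (J a (r * f)) k =
    action_coord n k (case_sum (case_sum (\<lambda>_. a) (Polynomial.coeff r)) (Polynomial.coeff f))"
proof -
  have cut: "(if i \<le> n then Polynomial.coeff p i else 0) = Polynomial.coeff p i"
    if "degree p \<le> n" for p :: "'a alg_closure poly" and i
    using that by (auto simp: coeff_eq_0)
  have "degree (r * f) \<le> 2 * n"
    using degree_mult_le[of r f] assms by simp
  then show ?thesis
    by (cases k) (simp_all add: action_coord_def cut assms coeff_J_0 coeff_J_Suc coeff_mult
        del: of_nat_Suc power_Suc cong: if_cong)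
qed

lemma ind_RB_simps [simp]:
  "stage ind_RB n = UNIV \<times> {r. r \<noteq> 0 \<and> degree r \<le> n}"
  "coords ind_RB n = UNIV <+> {..n}"
  "chart ind_RB n (a, r) = case_sum (\<lambda>_. a) (Polynomial.coeff r)"
  by (simp_all add: ind_RB_def ind_transport_def ind_line_def ind_poly_nonzero_def ind_prod_def Plus_def)

lemma pt_ind_RB:
  assumes "r \<noteq> 0"
  shows "pt ind_RB (J a \<circ> mult_op r) = (to_ac a, map_poly to_ac r)"
proof -
  have "inv_into (UNIV \<times> {r. r \<noteq> 0}) (\<lambda>(a, r). J a \<circ> mult_op r) (J a \<circ> mult_op r) = (a, r)"
    using inv_into_f_f[OF bij_betw_imp_inj_on[OF bij_betw_RB_ops], of "(a, r)"] assms by simp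
  then show ?thesis
    by (simp add: ind_RB_def ind_transport_def ind_line_def ind_poly_nonzero_def)
qed

lemma ind_poly_simps [simp]:
  "stage ind_poly n = {p. degree p \<le> n}"
  "coords ind_poly n = {..n}"
  "chart ind_poly n = Polynomial.coeff"
  "pt ind_poly = map_poly to_ac"
  by (simp_all add: ind_poly_def)

lemma ind_morphism_action:
  "ind_morphism (RB_ops \<times> UNIV) (ind_RB \<times>\<^sub>i ind_poly) UNIV ind_poly
     (\<lambda>(R, f :: 'a::field_char_0 poly). R f)"
  (is "ind_morphism _ ?A _ _ _")
proof -
  define \<Phi> :: "('a alg_closure \<times> 'a alg_closure poly) \<times> 'a alg_closure poly \<Rightarrow> 'a alg_closure poly"
    where "\<Phi> = (\<lambda>((a, r), f). J a (r * f))"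
  have A: "quasi_affine_ind_variety (RB_ops \<times> UNIV) ?A"
    by (intro quasi_affine_ind_variety_prod quasi_affine_ind_variety_RB quasi_affine_ind_variety_poly)
  \<comment> \<open>The product has degree at most \<open>2 * n\<close>, and integration raises the degree by one.\<close>
  have stages: "\<Phi> ` stage ?A n \<subseteq> stage ind_poly (Suc (2 * n))" for n
  proof -
    have "degree (J a (r * f)) \<le> Suc (2 * n)" if "degree r \<le> n" "degree f \<le> n"
      for a and r f :: "'a alg_closure poly"
      using degree_J_le[of a "r * f"] degree_mult_le[of r f] that by linarith
    then show ?thesis by (auto simp: \<Phi>_def)
  qed
  have "in_charts ?A n ind_poly m \<Phi> z k = action_coord n k z" if "z \<in> chart ?A n ` stage ?A n" for n m z k
    using that in_charts_chart[OF quasi_affine_ind_varietyD(1)[OF A], where B = ind_poly and m = m and \<Phi> = \<Phi>]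
    by (auto simp: \<Phi>_def coeff_J_mult_eq_action_coord)
  then have "regular_fun (coords ?A n) (chart ?A n ` stage ?A n) (\<lambda>z. in_charts ?A n ind_poly m \<Phi> z k)" for n m k
    using regular_fun_cong[of "chart ?A n ` stage ?A n" "\<lambda>z. in_charts ?A n ind_poly m \<Phi> z k" "action_coord n k"]
      regular_fun_poly_fun[OF action_coord_poly_fun] by simp
  moreover have "in_charts ?A n ind_poly (Suc (2 * n)) \<Phi> ` (chart ?A n ` stage ?A n)
      \<subseteq> chart ind_poly (Suc (2 * n)) ` stage ind_poly (Suc (2 * n))" for n
  proof (clarsimp simp del: ind_prod_simps(1,3) ind_RB_simps ind_poly_simps(1))
    fix a r f assume x: "((a, r), f) \<in> stage ?A n"
    then have "in_charts ?A n ind_poly (Suc (2 * n)) \<Phi> (chart ?A n ((a, r), f)) = Polynomial.coeff (\<Phi> ((a, r), f))"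
      using in_charts_chart[OF quasi_affine_ind_varietyD(1)[OF A] x, of ind_poly "Suc (2 * n)" \<Phi>] by simp
    then show "in_charts ?A n ind_poly (Suc (2 * n)) \<Phi> (chart ?A n ((a, r), f))
        \<in> Polynomial.coeff ` stage ind_poly (Suc (2 * n))"
      using x stages[of n] by blast
  qed
  ultimately have "variety_morphism (coords ?A n) (chart ?A n ` stage ?A n) (coords ind_poly (Suc (2 * n)))
      (chart ind_poly (Suc (2 * n)) ` stage ind_poly (Suc (2 * n))) (in_charts ?A n ind_poly (Suc (2 * n)) \<Phi>)" for n
    by (simp only: variety_morphism_def) blast
  moreover have "\<Phi> (pt ?A s) = pt ind_poly ((\<lambda>(R, f). R f) s)" if "s \<in> RB_ops \<times> UNIV" for s
    using that by (auto simp: RB_ops_def pt_ind_RB \<Phi>_def map_poly_to_ac_J map_poly_to_ac_mult)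
      (simp add: mult_op_def map_poly_to_ac_J map_poly_to_ac_mult)
  ultimately show ?thesis
    unfolding ind_morphism_def using A quasi_affine_ind_variety_poly stages by blast
qed

theorem proposition4p5:
  shows "bij_betw (\<lambda>(a, r). J a \<circ> mult_op r) (UNIV \<times> {r. r \<noteq> 0})
           (RB_ops :: ('a::field_char_0 poly \<Rightarrow> 'a poly) set) \<and>
         quasi_affine_ind_variety (RB_ops :: ('a poly \<Rightarrow> 'a poly) set) ind_RB \<and>
         ind_morphism (RB_ops \<times> UNIV) (ind_RB \<times>\<^sub>i ind_poly) UNIV ind_poly
           (\<lambda>(R, f :: 'a poly). R f)"
  using bij_betw_RB_ops quasi_affine_ind_variety_RB ind_morphism_action by blast

end
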